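(* Let $\mathfrak g$ be a finite-dimensional completely solvable Lie superalgebra over $\mathbf k$ with $N=\dim\mathfrak g$. Then (1) every minimal (graded) ideal of $\mathfrak g$ is one-dimensional; and (2) there exists a chain of graded ideals $\mathfrak g=\mathfrak g_0\supset\mathfrak g_1\supset\cdots\supset\mathfrak g_{N-1}\supset\mathfrak g_N=0$ of $\mathfrak g$ with $\dim\mathfrak g_i=N-i$ for all $i$.
   Context: $\mathbf k$ is algebraically closed of characteristic $p>2$. A Lie superalgebra $\mathfrak g$ is completely solvable if its derived sub-superalgebra $\mathfrak g^{(1)}=[\mathfrak g,\mathfrak g]$ is nilpotent. Ideals are $\mathbb Z_2$-graded. *)

theory Defs
  imports Main "HOL-Computational_Algebra.Polynomial"
begin

text \<open>Algebraically closed field: every nonconstant polynomial has a root.\<close>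
definition alg_closed_field :: "'k::field itself \<Rightarrow> bool" where
  "alg_closed_field _ \<longleftrightarrow> (\<forall>q::'k poly. degree q > 0 \<longrightarrow> (\<exists>x. poly q x = 0))"

text \<open>A Lie superalgebra structure on the whole type 'v, which is a vector space over 'k
  via scale, with Z2-grading given by the subspaces G 0 (even) and G 1 (odd)
  and bracket br. Parities are encoded as the naturals 0 and 1.\<close>
definition lie_superalgebra ::
  "('k::field \<Rightarrow> 'v::ab_group_add \<Rightarrow> 'v) \<Rightarrow> (nat \<Rightarrow> 'v set) \<Rightarrow> ('v \<Rightarrow> 'v \<Rightarrow> 'v) \<Rightarrow> bool" where
  "lie_superalgebra scale G br \<longleftrightarrow>
     vector_space scale \<and>
     module.subspace scale (G 0) \<and> module.subspace scale (G 1) \<and>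
     G 0 \<inter> G 1 = {0} \<and> (\<forall>v. \<exists>v0\<in>G 0. \<exists>v1\<in>G 1. v = v0 + v1) \<and>
     (\<forall>x y z. br (x + y) z = br x z + br y z) \<and>
     (\<forall>x y z. br x (y + z) = br x y + br x z) \<and>
     (\<forall>c x y. br (scale c x) y = scale c (br x y)) \<and>
     (\<forall>c x y. br x (scale c y) = scale c (br x y)) \<and>
     (\<forall>a b x y. a < 2 \<longrightarrow> b < 2 \<longrightarrow> x \<in> G a \<longrightarrow> y \<in> G b \<longrightarrow> br x y \<in> G ((a + b) mod 2)) \<and>
     (\<forall>a b x y. a < 2 \<longrightarrow> b < 2 \<longrightarrow> x \<in> G a \<longrightarrow> y \<in> G b \<longrightarrow>
        br x y = - scale ((-1) ^ (a * b)) (br y x)) \<and>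
     (\<forall>a b c x y z. a < 2 \<longrightarrow> b < 2 \<longrightarrow> c < 2 \<longrightarrow> x \<in> G a \<longrightarrow> y \<in> G b \<longrightarrow> z \<in> G c \<longrightarrow>
        scale ((-1) ^ (a * c)) (br x (br y z)) + scale ((-1) ^ (b * a)) (br y (br z x))
          + scale ((-1) ^ (c * b)) (br z (br x y)) = 0) \<and>
     (\<forall>y \<in> G 1. br y (br y y) = 0)"

definition fin_dim :: "('k::field \<Rightarrow> 'v::ab_group_add \<Rightarrow> 'v) \<Rightarrow> bool" where
  "fin_dim scale \<longleftrightarrow> (\<exists>B. finite B \<and> module.span scale B = UNIV)"

text \<open>Graded (Z2-homogeneous) ideal.\<close>
definition graded_ideal ::
  "('k::field \<Rightarrow> 'v::ab_group_add \<Rightarrow> 'v) \<Rightarrow> (nat \<Rightarrow> 'v set) \<Rightarrow> ('v \<Rightarrow> 'v \<Rightarrow> 'v) \<Rightarrow> 'v set \<Rightarrow> bool" where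
  "graded_ideal scale G br I \<longleftrightarrow>
     module.subspace scale I \<and>
     (\<forall>v\<in>I. \<forall>v0\<in>G 0. \<forall>v1\<in>G 1. v = v0 + v1 \<longrightarrow> v0 \<in> I \<and> v1 \<in> I) \<and>
     (\<forall>x y. y \<in> I \<longrightarrow> br x y \<in> I \<and> br y x \<in> I)"

definition minimal_graded_ideal ::
  "('k::field \<Rightarrow> 'v::ab_group_add \<Rightarrow> 'v) \<Rightarrow> (nat \<Rightarrow> 'v set) \<Rightarrow> ('v \<Rightarrow> 'v \<Rightarrow> 'v) \<Rightarrow> 'v set \<Rightarrow> bool" where
  "minimal_graded_ideal scale G br I \<longleftrightarrow>
     graded_ideal scale G br I \<and> I \<noteq> {0} \<and>
     (\<forall>J. graded_ideal scale G br J \<longrightarrow> J \<subseteq> I \<longrightarrow> J = {0} \<or> J = I)"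

text \<open>Derived sub-superalgebra [g,g].\<close>
definition derived ::
  "('k::field \<Rightarrow> 'v::ab_group_add \<Rightarrow> 'v) \<Rightarrow> ('v \<Rightarrow> 'v \<Rightarrow> 'v) \<Rightarrow> 'v set" where
  "derived scale br = module.span scale {br x y | x y. True}"

text \<open>Lower central series of a sub-superalgebra S: C^0 = S, C^(n+1) = span [S, C^n].\<close>
fun lcs :: "('k::field \<Rightarrow> 'v::ab_group_add \<Rightarrow> 'v) \<Rightarrow> ('v \<Rightarrow> 'v \<Rightarrow> 'v) \<Rightarrow> 'v set \<Rightarrow> nat \<Rightarrow> 'v set" where
  "lcs scale br S 0 = S"
| "lcs scale br S (Suc n) = module.span scale {br x y | x y. x \<in> S \<and> y \<in> lcs scale br S n}"

definition nilpotent_sub ::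
  "('k::field \<Rightarrow> 'v::ab_group_add \<Rightarrow> 'v) \<Rightarrow> ('v \<Rightarrow> 'v \<Rightarrow> 'v) \<Rightarrow> 'v set \<Rightarrow> bool" where
  "nilpotent_sub scale br S \<longleftrightarrow> (\<exists>n. lcs scale br S n = {0})"

definition completely_solvable ::
  "('k::field \<Rightarrow> 'v::ab_group_add \<Rightarrow> 'v) \<Rightarrow> ('v \<Rightarrow> 'v \<Rightarrow> 'v) \<Rightarrow> bool" where
  "completely_solvable scale br \<longleftrightarrow> nilpotent_sub scale br (derived scale br)"

end

theory Submission
  imports Defs
begin

text \<open>This is Lie's theorem for graded ideals. Given graded ideals \<open>J \<subset> K\<close>, the
  vectors of \<open>K\<close> that every homogeneous element of the derived algebra sends into \<open>J\<close>
  form a graded subspace, stable under all homogeneous brackets and strictly larger than \<open>J\<close>,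
  because the derived algebra is nilpotent. Inside it the elements of a homogeneous spanning set have a
  common eigenvector modulo \<open>J\<close>: an even element has an eigenvector because the field is
  algebraically closed, an odd element \<open>b\<close> acts with square \<open>[[b,b],-]/2\<close>, which is zero
  modulo \<open>J\<close>, so it has the eigenvalue 0; and each such eigenspace is again stable, since
  brackets with derived elements vanish modulo \<open>J\<close>. A homogeneous common eigenvector \<open>w\<close>
  makes \<open>J + k w\<close> a graded ideal of dimension \<open>dim J + 1\<close> inside \<open>K\<close>. Repeating this from
  \<open>0\<close> gives the chain, and applying it to \<open>0 \<subset> I\<close> shows that minimal graded ideals are
  one-dimensional.\<close>

section \<open>Linear algebra\<close>

lemma two_ne_zero_if_CHAR_gt_2: "CHAR('a::semiring_1) > 2 \<Longrightarrow> (2::'a) \<noteq> 0"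
  using of_nat_eq_0_iff_char_dvd[of 2, where 'a = 'a] by (auto dest: dvd_imp_le)

lemma finite_dimensional_vector_spaceI:
  assumes "vector_space scale" "fin_dim scale"
  shows "\<exists>B. finite_dimensional_vector_space scale B"
proof -
  interpret vector_space scale by fact
  obtain B0 where B0: "finite B0" "span B0 = UNIV"
    using assms(2) unfolding fin_dim_def by blast
  obtain B where B: "independent B" "UNIV \<subseteq> span B"
    using basis_exists[of UNIV] by blast
  then have "finite B" using independent_span_bound[OF B0(1)] B0(2) by simp
  with B have "finite_dimensional_vector_space scale B"
    by (auto simp: finite_dimensional_vector_space_def finite_dimensional_vector_space_axioms_def
        vector_space_axioms)
  then show ?thesis by blast
qed

definition poly_apply ::
    "('a::field \<Rightarrow> 'b::ab_group_add \<Rightarrow> 'b) \<Rightarrow> ('b \<Rightarrow> 'b) \<Rightarrow> 'a poly \<Rightarrow> 'b \<Rightarrow> 'b" where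
  "poly_apply scale T p v = (\<Sum>i\<le>degree p. scale (coeff p i) ((T ^^ i) v))"

context vector_space
begin

lemma span_insert_subspace_iff:
  assumes "subspace J"
  shows "y \<in> span (insert w J) \<longleftrightarrow> (\<exists>k. \<exists>j\<in>J. y = k *s w + j)"
proof -
  have "y - k *s w \<in> J \<longleftrightarrow> (\<exists>j\<in>J. y = k *s w + j)" for k
    by (metis add_diff_cancel_left' diff_add_cancel add.commute)
  then show ?thesis unfolding span_insert span_eq_iff[THEN iffD2, OF assms] by blast
qed

lemma poly_apply_eq_sum:
  "degree p < n \<Longrightarrow> poly_apply (*s) T p v = (\<Sum>i<n. coeff p i *s (T ^^ i) v)"
  unfolding poly_apply_def by (rule sum.mono_neutral_left) (auto simp: coeff_eq_0)

lemma poly_apply_const [simp]: "poly_apply (*s) T [:c:] v = c *s v"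
  by (simp add: poly_apply_def)

lemma poly_apply_add: "poly_apply (*s) T (p + q) v = poly_apply (*s) T p v + poly_apply (*s) T q v"
proof -
  define n where "n = Suc (max (degree p) (degree q))"
  have "degree (p + q) < n" "degree p < n" "degree q < n"
    using degree_add_le[of p "max (degree p) (degree q)" q] by (auto simp: n_def)
  then show ?thesis
    by (simp add: poly_apply_eq_sum scale_left_distrib sum.distrib)
qed

lemma poly_apply_smult: "poly_apply (*s) T (smult c p) v = c *s poly_apply (*s) T p v"
proof -
  have deg: "degree (smult c p) < Suc (degree p)"
    using degree_smult_le[of c p] by simp
  show ?thesis
    unfolding poly_apply_eq_sum[OF deg] poly_apply_eq_sum[OF lessI[of "degree p"]]
    by (simp only: coeff_smult scale_scale[symmetric] scale_sum_right)
qed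

lemma poly_apply_pCons_zero:
  assumes "Vector_Spaces.linear (*s) (*s) T"
  shows "poly_apply (*s) T (pCons 0 q) v = T (poly_apply (*s) T q v)"
proof -
  interpret T: Vector_Spaces.linear "(*s)" "(*s)" T by fact
  have "degree (pCons 0 q) < Suc (Suc (degree q))"
    using degree_pCons_le[of 0 q] by simp
  then have "poly_apply (*s) T (pCons 0 q) v
      = (\<Sum>i<Suc (Suc (degree q)). coeff (pCons 0 q) i *s (T ^^ i) v)"
    by (rule poly_apply_eq_sum)
  also have "\<dots> = (\<Sum>i<Suc (degree q). coeff q i *s (T ^^ Suc i) v)"
    by (subst sum.lessThan_Suc_shift) simp
  also have "\<dots> = (\<Sum>i<Suc (degree q). T (coeff q i *s (T ^^ i) v))"
    by (simp add: T.scale)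
  also have "\<dots> = T (poly_apply (*s) T q v)"
    by (simp only: T.sum poly_apply_eq_sum[OF lessI])
  finally show ?thesis .
qed

lemma poly_apply_linear_factor:
  assumes "Vector_Spaces.linear (*s) (*s) T"
  shows "poly_apply (*s) T ([:-a, 1:] * q) v = T (poly_apply (*s) T q v) - a *s poly_apply (*s) T q v"
proof -
  have "[:-a, 1:] * q = smult (-a) q + pCons 0 q" by simp
  then show ?thesis
    by (simp only: poly_apply_add poly_apply_smult poly_apply_pCons_zero[OF assms]) simp
qed

lemma poly_apply_in_subspace:
  assumes "subspace S" "v \<in> S" "\<And>x. x \<in> S \<Longrightarrow> T x \<in> S"
  shows "poly_apply (*s) T p v \<in> S"
proof -
  have "(T ^^ i) v \<in> S" for i by (induction i) (auto simp: assms)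
  then show ?thesis
    unfolding poly_apply_def using assms(1) by (intro subspace_sum subspace_scale) auto
qed

text \<open>Peel off linear factors \<open>X - a\<close> of \<open>p\<close>: as soon as the remaining factor \<open>q\<close> no
  longer sends \<open>u\<close> into \<open>J\<close>, the vector \<open>q(T) u\<close> is an eigenvector modulo \<open>J\<close>.\<close>
lemma eigenvector_mod_subspace_of_poly:
  assumes "alg_closed_field TYPE('a)" "Vector_Spaces.linear (*s) (*s) T"
    and "subspace S" "subspace J" "\<And>x. x \<in> S \<Longrightarrow> T x \<in> S"
    and "u \<in> S" "u \<notin> J" "p \<noteq> 0" "poly_apply (*s) T p u \<in> J"
  shows "\<exists>l v. v \<in> S \<and> v \<notin> J \<and> T v - l *s v \<in> J"
  using assms(8,9)
proof (induction "degree p" arbitrary: p rule: less_induct)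
  case less
  show ?case
  proof (cases "degree p = 0")
    case True
    then obtain c where p: "p = [:c:]" and "c \<noteq> 0"
      using less.prems by (metis degree_0_id pCons_eq_0_iff)
    then have "(1/c) *s (c *s u) \<in> J"
      using less.prems(2) assms(4) subspace_scale by (metis poly_apply_const)
    then show ?thesis using \<open>c \<noteq> 0\<close> assms(7) by simp
  next
    case False
    then obtain a where "poly p a = 0"
      using assms(1) unfolding alg_closed_field_def by blast
    then obtain q where q: "p = [:-a, 1:] * q"
      by (metis dvdE poly_eq_0_iff_dvd)
    with less.prems have "q \<noteq> 0" by auto
    then have "degree q < degree p"
      unfolding q using degree_mult_eq[of "[:-a, 1:]" q] by simp
    show ?thesis
    proof (cases "poly_apply (*s) T q u \<in> J")
      case True
      then show ?thesis using less.hyps \<open>degree q < degree p\<close> \<open>q \<noteq> 0\<close> by blast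
    next
      case False
      moreover have "poly_apply (*s) T q u \<in> S"
        using poly_apply_in_subspace assms(3,5,6) by blast
      moreover have "T (poly_apply (*s) T q u) - a *s poly_apply (*s) T q u \<in> J"
        using less.prems(2) unfolding q poly_apply_linear_factor[OF assms(2)] .
      ultimately show ?thesis by blast
    qed
  qed
qed

end

context finite_dimensional_vector_space
begin

lemma exists_nontrivial_linear_relation:
  assumes "finite A" "card A > dim (UNIV :: 'b set)"
  shows "\<exists>c. (\<exists>i\<in>A. c i \<noteq> 0) \<and> (\<Sum>i\<in>A. c i *s f i) = 0"
proof (cases "inj_on f A")
  case False
  then obtain i j where ij: "i \<in> A" "j \<in> A" "i \<noteq> j" "f i = f j"
    unfolding inj_on_def by blast
  define c :: "_ \<Rightarrow> 'a" where "c k = (if k = i then 1 else 0) - (if k = j then 1 else 0)" for k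
  have "(\<Sum>k\<in>A. c k *s f k)
      = (\<Sum>k\<in>A. if k = i then f k else 0) - (\<Sum>k\<in>A. if k = j then f k else 0)"
    unfolding c_def scale_left_diff_distrib sum_subtractf by (intro arg_cong2[where f = minus] sum.cong) auto
  also have "\<dots> = 0" using ij by (simp add: sum.delta[OF assms(1)])
  finally have "(\<Sum>k\<in>A. c k *s f k) = 0" .
  moreover have "c i \<noteq> 0" using ij by (simp add: c_def)
  ultimately show ?thesis using ij(1) by blast
next
  case True
  have "dependent (f ` A)"
  proof (rule ccontr)
    assume "independent (f ` A)"
    then have "card (f ` A) \<le> dim (UNIV :: 'b set)"
      by (rule independent_card_le_dim[OF subset_UNIV])
    then show False using assms(2) card_image[OF True] by simp
  qed
  then obtain w where "\<exists>v\<in>f ` A. w v \<noteq> 0" "(\<Sum>v\<in>f ` A. w v *s v) = 0"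
    using dependent_finite[of "f ` A"] assms(1) by blast
  then show ?thesis
    by (intro exI[of _ "w \<circ> f"]) (auto simp: sum.reindex[OF True])
qed

lemma exists_annihilating_poly: "\<exists>p. p \<noteq> 0 \<and> poly_apply (*s) T p u = 0"
proof -
  define m where "m = card Basis"
  have "card {..m} > dim (UNIV :: 'b set)" by (simp add: m_def)
  then obtain c where c: "\<exists>i\<in>{..m}. c i \<noteq> 0" "(\<Sum>i\<le>m. c i *s (T ^^ i) u) = 0"
    using exists_nontrivial_linear_relation[of "{..m}" "\<lambda>i. (T ^^ i) u"] by blast
  define p where "p = (\<Sum>i\<le>m. monom (c i) i)"
  have coeff_p: "coeff p k = (if k \<le> m then c k else 0)" for k
    unfolding p_def coeff_sum coeff_monom by (simp add: sum.delta)
  have "degree p < Suc m"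
    using coeff_p by (intro le_imp_less_Suc degree_le) auto
  then have "poly_apply (*s) T p u = (\<Sum>i\<le>m. c i *s (T ^^ i) u)"
    unfolding poly_apply_eq_sum[OF \<open>degree p < Suc m\<close>] lessThan_Suc_atMost
    by (intro sum.cong) (simp_all add: coeff_p)
  moreover obtain i where "i \<le> m" "c i \<noteq> 0" using c(1) by auto
  then have "coeff p i \<noteq> 0" by (simp add: coeff_p)
  then have "p \<noteq> 0" by auto
  ultimately show ?thesis using c(2) by metis
qed

lemma eigenvector_mod_subspace:
  assumes "alg_closed_field TYPE('a)" "Vector_Spaces.linear (*s) (*s) T"
    and "subspace S" "subspace J" "\<And>x. x \<in> S \<Longrightarrow> T x \<in> S" "\<not> S \<subseteq> J"
  shows "\<exists>l v. v \<in> S \<and> v \<notin> J \<and> T v - l *s v \<in> J"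
proof -
  obtain u where "u \<in> S" "u \<notin> J" using assms(6) by blast
  moreover obtain p where "p \<noteq> 0" "poly_apply (*s) T p u = 0"
    using exists_annihilating_poly by blast
  moreover have "(0 :: 'b) \<in> J" using assms(4) subspace_0 by blast
  ultimately show ?thesis using eigenvector_mod_subspace_of_poly[OF assms(1-5)] by metis
qed

end

section \<open>Finite-dimensional Lie superalgebras\<close>

lemma parity_cases: "a < 2 \<Longrightarrow> (a = 0 \<Longrightarrow> P) \<Longrightarrow> (a = 1 \<Longrightarrow> P) \<Longrightarrow> P"
  for a :: nat by linarith

locale fd_lie_superalgebra = finite_dimensional_vector_space scale Basis
  for scale :: "'k::field \<Rightarrow> 'v::ab_group_add \<Rightarrow> 'v" (infixr \<open>*s\<close> 75) and Basis :: "'v set" +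
  fixes G :: "nat \<Rightarrow> 'v set" and br :: "'v \<Rightarrow> 'v \<Rightarrow> 'v"
  assumes lie_superalgebra: "lie_superalgebra scale G br"
begin

lemma
  shows subspace_even: "subspace (G 0)"
    and subspace_odd: "subspace (G 1)"
    and even_inter_odd: "G 0 \<inter> G 1 = {0}"
    and even_odd_decomposition: "\<exists>v0\<in>G 0. \<exists>v1\<in>G 1. v = v0 + v1"
    and bracket_add_left: "br (x + y) z = br x z + br y z"
    and bracket_add_right: "br x (y + z) = br x y + br x z"
    and bracket_scale_left: "br (c *s x) y = c *s br x y"
    and bracket_scale_right: "br x (c *s y) = c *s br x y"
  using lie_superalgebra unfolding lie_superalgebra_def by (auto 0 0)

lemma bracket_grading:
  "a < 2 \<Longrightarrow> b < 2 \<Longrightarrow> x \<in> G a \<Longrightarrow> y \<in> G b \<Longrightarrow> br x y \<in> G ((a + b) mod 2)"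
  using lie_superalgebra unfolding lie_superalgebra_def by blast

lemma bracket_super_antisym:
  "a < 2 \<Longrightarrow> b < 2 \<Longrightarrow> x \<in> G a \<Longrightarrow> y \<in> G b \<Longrightarrow> br x y = - ((-1) ^ (a * b) *s br y x)"
  using lie_superalgebra unfolding lie_superalgebra_def by blast

lemma super_jacobi:
  "a < 2 \<Longrightarrow> b < 2 \<Longrightarrow> c < 2 \<Longrightarrow> x \<in> G a \<Longrightarrow> y \<in> G b \<Longrightarrow> z \<in> G c \<Longrightarrow>
    (-1) ^ (a * c) *s br x (br y z) + (-1) ^ (b * a) *s br y (br z x)
      + (-1) ^ (c * b) *s br z (br x y) = 0"
  using lie_superalgebra unfolding lie_superalgebra_def by blast

lemma bracket_zero_left [simp]: "br 0 y = 0"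
  using bracket_add_left[of 0 0 y] by simp

lemma bracket_zero_right [simp]: "br x 0 = 0"
  using bracket_add_right[of x 0 0] by simp

lemma bracket_minus_right: "br x (- y) = - br x y"
  using bracket_add_right[of x y "- y"] by (simp add: eq_neg_iff_add_eq_0 add.commute)

lemma bracket_diff_right: "br x (y - z) = br x y - br x z"
  using bracket_add_right[of x y "- z"] by (simp add: bracket_minus_right)

lemma linear_bracket_left: "Vector_Spaces.linear (*s) (*s) (\<lambda>x. br x y)"
  by (simp add: Vector_Spaces.linear_iff vector_space_axioms bracket_add_left bracket_scale_left)

lemma linear_bracket_right: "Vector_Spaces.linear (*s) (*s) (br x)"
  by (simp add: Vector_Spaces.linear_iff vector_space_axioms bracket_add_right bracket_scale_right)

lemma even_odd_unique:
  assumes "v0 + v1 = w0 + w1" "v0 \<in> G 0" "w0 \<in> G 0" "v1 \<in> G 1" "w1 \<in> G 1"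
  shows "v0 = w0 \<and> v1 = w1"
proof -
  have "v0 - w0 = w1 - v1" using assms(1) by (simp add: algebra_simps)
  moreover have "v0 - w0 \<in> G 0" "w1 - v1 \<in> G 1"
    using assms subspace_even subspace_odd subspace_diff by blast+
  ultimately have "v0 - w0 \<in> G 0 \<inter> G 1" by simp
  then have "v0 - w0 = 0" using even_inter_odd by blast
  then show ?thesis using assms(1) by auto
qed

lemma super_derivation_homogeneous:
  assumes "a < 2" "c < 2" "e < 2" "b \<in> G a" "x \<in> G c" "v \<in> G e"
  shows "br b (br x v) = br (br b x) v + (-1) ^ (a * c) *s br x (br b v)"
proof -
  have "br v b = - ((-1) ^ (e * a) *s br b v)"
    using bracket_super_antisym assms by blast
  moreover have "br v (br b x) = - ((-1) ^ (e * ((a + c) mod 2)) *s br (br b x) v)"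
    using bracket_super_antisym[OF assms(3) _ assms(6) bracket_grading[OF assms(1,2,4,5)]] by simp
  moreover note super_jacobi[OF assms(1,2,3) assms(4,5,6)]
  ultimately show ?thesis
    using assms(1-3)
    by (elim parity_cases) (simp_all add: bracket_minus_right bracket_scale_right algebra_simps)
qed

lemma super_derivation:
  assumes "a < 2" "c < 2" "b \<in> G a" "x \<in> G c"
  shows "br b (br x v) = br (br b x) v + (-1) ^ (a * c) *s br x (br b v)"
proof -
  obtain v0 v1 where "v0 \<in> G 0" "v1 \<in> G 1" "v = v0 + v1"
    using even_odd_decomposition by blast
  then show ?thesis
    using super_derivation_homogeneous[OF assms(1,2) _ assms(3,4), of 0 v0]
      super_derivation_homogeneous[OF assms(1,2) _ assms(3,4), of 1 v1]
    by (simp add: bracket_add_left bracket_add_right scale_right_distrib)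
qed

lemma odd_bracket_square:
  assumes "b \<in> G 1"
  shows "2 *s br b (br b v) = br (br b b) v"
proof -
  have "br b (br b v) + br b (br b v) = br (br b b) v"
    using super_derivation[OF _ _ assms assms, of v] by (simp add: eq_diff_eq)
  then show ?thesis by (metis one_add_one scale_left_distrib scale_one)
qed

definition homogeneous :: "'v \<Rightarrow> bool" where
  "homogeneous x \<longleftrightarrow> (\<exists>a<2. x \<in> G a)"

definition graded :: "'v set \<Rightarrow> bool" where
  "graded S \<longleftrightarrow> (\<forall>v\<in>S. \<forall>v0\<in>G 0. \<forall>v1\<in>G 1. v = v0 + v1 \<longrightarrow> v0 \<in> S \<and> v1 \<in> S)"

abbreviation gr_ideal :: "'v set \<Rightarrow> bool" where
  "gr_ideal I \<equiv> graded_ideal (*s) G br I"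

lemma gr_ideal_iff:
  "gr_ideal I \<longleftrightarrow> subspace I \<and> graded I \<and> (\<forall>x y. y \<in> I \<longrightarrow> br x y \<in> I \<and> br y x \<in> I)"
  unfolding graded_ideal_def graded_def by blast

lemma
  assumes "gr_ideal I"
  shows gr_ideal_subspace: "subspace I"
    and gr_ideal_graded: "graded I"
    and gr_ideal_bracket_left: "y \<in> I \<Longrightarrow> br x y \<in> I"
    and gr_ideal_bracket_right: "y \<in> I \<Longrightarrow> br y x \<in> I"
  using assms unfolding gr_ideal_iff by blast+

lemma gr_ideal_zero: "gr_ideal {0}"
proof -
  have "v0 = 0 \<and> v1 = 0" if "v0 \<in> G 0" "v1 \<in> G 1" "0 = v0 + v1" for v0 v1
    using even_odd_unique[of v0 v1 0 0] that subspace_even subspace_odd subspace_0 by auto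
  then show ?thesis
    unfolding gr_ideal_iff graded_def by (auto simp: subspace_single_0)
qed

lemma gr_ideal_UNIV: "gr_ideal UNIV"
  unfolding gr_ideal_iff graded_def by simp

lemma graded_split:
  assumes "graded J" "p + q \<in> J" "a < 2" "p \<in> G a" "q \<in> G ((a + 1) mod 2)"
  shows "p \<in> J \<and> q \<in> J"
  using assms(3)
proof (elim parity_cases)
  assume "a = 0"
  then have "p \<in> G 0" "q \<in> G 1" using assms(4,5) by simp_all
  then show ?thesis using assms(1,2) unfolding graded_def by blast
next
  assume "a = 1"
  then have "q \<in> G 0" "p \<in> G 1" using assms(4,5) by simp_all
  moreover have "q + p \<in> J" using assms(2) by (simp add: add.commute)
  ultimately show ?thesis using assms(1) unfolding graded_def by blast
qed

lemma homogeneous_even: "x \<in> G 0 \<Longrightarrow> homogeneous x"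
  unfolding homogeneous_def by (intro exI[of _ 0]) simp

lemma homogeneous_odd: "x \<in> G 1 \<Longrightarrow> homogeneous x"
  unfolding homogeneous_def by (intro exI[of _ 1]) simp

lemma homogeneous_bracket:
  assumes "homogeneous x" "homogeneous y"
  shows "homogeneous (br x y)"
proof -
  obtain a b where "a < 2" "b < 2" "x \<in> G a" "y \<in> G b"
    using assms unfolding homogeneous_def by blast
  then have "br x y \<in> G ((a + b) mod 2)" by (rule bracket_grading)
  then show ?thesis unfolding homogeneous_def by (intro exI[of _ "(a + b) mod 2"]) simp
qed

lemma bracket_mem_derived: "br x y \<in> derived (*s) br"
  unfolding derived_def by (rule span_base) blast

section \<open>Lie's theorem for graded ideals\<close>

definition derived_kernel :: "'v set \<Rightarrow> 'v set \<Rightarrow> 'v set" where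
  "derived_kernel J K = {v \<in> K. \<forall>d \<in> derived (*s) br. homogeneous d \<longrightarrow> br d v \<in> J}"

lemma subspace_derived_kernel:
  assumes "subspace J" "subspace K"
  shows "subspace (derived_kernel J K)"
  using assms unfolding subspace_def derived_kernel_def
  by (simp add: bracket_add_right bracket_scale_right)

lemma graded_derived_kernel:
  assumes "gr_ideal J" "graded K"
  shows "graded (derived_kernel J K)"
  unfolding graded_def
proof (intro ballI impI)
  fix v v0 v1
  assume v: "v \<in> derived_kernel J K" "v0 \<in> G 0" "v1 \<in> G 1" "v = v0 + v1"
  have "br d v0 \<in> J \<and> br d v1 \<in> J" if "d \<in> derived (*s) br" "homogeneous d" for d
  proof -
    obtain a where a: "a < 2" "d \<in> G a" using \<open>homogeneous d\<close> homogeneous_def by blast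
    have "br d v0 + br d v1 \<in> J"
      using v that unfolding derived_kernel_def by (simp add: bracket_add_right)
    moreover have "br d v0 \<in> G a" "br d v1 \<in> G ((a + 1) mod 2)"
      using bracket_grading[OF a(1) _ a(2) v(2)] bracket_grading[OF a(1) _ a(2) v(3)] a(1) by simp_all
    ultimately show ?thesis using graded_split gr_ideal_graded[OF assms(1)] a(1) by blast
  qed
  moreover have "v0 \<in> K" "v1 \<in> K"
    using assms(2) v unfolding graded_def derived_kernel_def by blast+
  ultimately show "v0 \<in> derived_kernel J K \<and> v1 \<in> derived_kernel J K"
    unfolding derived_kernel_def by blast
qed

lemma derived_kernel_bracket:
  assumes "gr_ideal J" "gr_ideal K" "homogeneous x" "v \<in> derived_kernel J K"
  shows "br x v \<in> derived_kernel J K"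
proof -
  obtain c where c: "c < 2" "x \<in> G c" using assms(3) homogeneous_def by blast
  have "br d (br x v) \<in> J" if "d \<in> derived (*s) br" "homogeneous d" for d
  proof -
    obtain a where a: "a < 2" "d \<in> G a" using \<open>homogeneous d\<close> homogeneous_def by blast
    have "br (br d x) v \<in> J"
      using assms(3,4) that bracket_mem_derived homogeneous_bracket
      unfolding derived_kernel_def by blast
    moreover have "br x (br d v) \<in> J"
      using assms(4) that gr_ideal_bracket_left[OF assms(1)] unfolding derived_kernel_def by blast
    ultimately show ?thesis
      unfolding super_derivation[OF a(1) c(1) a(2) c(2)]
      using gr_ideal_subspace[OF assms(1)] by (simp add: subspace_add subspace_scale)
  qed
  moreover have "br x v \<in> K"
    using assms(4) gr_ideal_bracket_left[OF assms(2)] unfolding derived_kernel_def by blast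
  ultimately show ?thesis unfolding derived_kernel_def by blast
qed

primrec iterated_brackets :: "'v set \<Rightarrow> nat \<Rightarrow> 'v set" where
  "iterated_brackets K 0 = K"
| "iterated_brackets K (Suc n) =
    {br d v | d v. d \<in> derived (*s) br \<and> homogeneous d \<and> v \<in> iterated_brackets K n}"

lemma iterated_brackets_subset_lcs:
  "iterated_brackets K (Suc n) \<subseteq> lcs (*s) br (derived (*s) br) n"
proof (induction n)
  case 0
  then show ?case using bracket_mem_derived by auto
next
  case (Suc n)
  show ?case
  proof
    fix z assume "z \<in> iterated_brackets K (Suc (Suc n))"
    then obtain d v where z: "z = br d v" "d \<in> derived (*s) br" "v \<in> iterated_brackets K (Suc n)"
      by auto
    with Suc.IH have "v \<in> lcs (*s) br (derived (*s) br) n" by blast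
    with z show "z \<in> lcs (*s) br (derived (*s) br) (Suc n)"
      by (auto intro!: span_base)
  qed
qed

lemma iterated_brackets_subset: "gr_ideal K \<Longrightarrow> iterated_brackets K n \<subseteq> K"
  by (induction n) (auto simp: gr_ideal_bracket_left)

text \<open>If the derived kernel lay inside \<open>J\<close>, descending induction would push every
  iterated bracket into \<open>J\<close>, down to \<open>K\<close> itself; nilpotency of the derived algebra starts
  the induction.\<close>
lemma derived_kernel_not_subset:
  assumes "nilpotent_sub (*s) br (derived (*s) br)"
    and "gr_ideal J" "gr_ideal K" "J \<subset> K"
  shows "\<not> derived_kernel J K \<subseteq> J"
proof
  assume kernel_in_J: "derived_kernel J K \<subseteq> J"
  obtain n where n: "lcs (*s) br (derived (*s) br) n = {0}"
    using assms(1) unfolding nilpotent_sub_def by blast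
  have "iterated_brackets K m \<subseteq> J" if "m \<le> Suc n" for m
    using that
  proof (induction m rule: inc_induct)
    case base
    have "iterated_brackets K (Suc n) \<subseteq> {0}"
      using iterated_brackets_subset_lcs[of K n] unfolding n .
    then show ?case using subspace_0[OF gr_ideal_subspace[OF assms(2)]] by blast
  next
    case (step m)
    show ?case
    proof
      fix v assume "v \<in> iterated_brackets K m"
      then have "v \<in> derived_kernel J K"
        using step.IH iterated_brackets_subset[OF assms(3), of m]
        unfolding derived_kernel_def by auto
      then show "v \<in> J" using kernel_in_J by blast
    qed
  qed
  from this[of 0] show False using assms(4) by simp
qed

text \<open>The subspaces in which a common eigenvector modulo \<open>J\<close> is sought.\<close>
definition admissible :: "'v set \<Rightarrow> 'v set \<Rightarrow> 'v set \<Rightarrow> bool" where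
  "admissible J K S \<longleftrightarrow> subspace S \<and> J \<subseteq> S \<and> S \<subseteq> derived_kernel J K \<and> \<not> S \<subseteq> J \<and>
     graded S \<and> (\<forall>x v. homogeneous x \<longrightarrow> v \<in> S \<longrightarrow> br x v \<in> S)"

lemma admissible_derived_kernel:
  assumes "nilpotent_sub (*s) br (derived (*s) br)"
    and "gr_ideal J" "gr_ideal K" "J \<subset> K"
  shows "admissible J K (derived_kernel J K)"
  unfolding admissible_def
proof (intro conjI allI impI)
  show "subspace (derived_kernel J K)"
    using subspace_derived_kernel gr_ideal_subspace assms(2,3) by blast
  show "J \<subseteq> derived_kernel J K"
    using assms(4) gr_ideal_bracket_left[OF assms(2)] unfolding derived_kernel_def by blast
  show "\<not> derived_kernel J K \<subseteq> J" by (rule derived_kernel_not_subset[OF assms])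
  show "graded (derived_kernel J K)"
    using graded_derived_kernel[OF assms(2) gr_ideal_graded[OF assms(3)]] .
  show "br x v \<in> derived_kernel J K" if "homogeneous x" "v \<in> derived_kernel J K" for x v
    using derived_kernel_bracket[OF assms(2,3) that] .
qed simp

definition eigenspace_mod :: "'v set \<Rightarrow> 'v set \<Rightarrow> 'v \<Rightarrow> 'k \<Rightarrow> 'v set" where
  "eigenspace_mod J S b l = {v \<in> S. br b v - l *s v \<in> J}"

lemma subspace_eigenspace_mod:
  assumes "subspace J" "subspace S"
  shows "subspace (eigenspace_mod J S b l)"
proof -
  have "br b (x + y) - l *s (x + y) = (br b x - l *s x) + (br b y - l *s y)"
    and "br b (c *s x) - l *s (c *s x) = c *s (br b x - l *s x)" for x y c
    by (simp_all add: bracket_add_right bracket_scale_right algebra_simps)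
  then show ?thesis
    using assms unfolding subspace_def eigenspace_mod_def by simp
qed

lemma graded_eigenspace_mod:
  assumes "gr_ideal J" "graded S" "a < 2" "b \<in> G a" "a = 0 \<or> l = 0"
  shows "graded (eigenspace_mod J S b l)"
  unfolding graded_def
proof (intro ballI impI)
  fix v v0 v1
  assume v: "v \<in> eigenspace_mod J S b l" "v0 \<in> G 0" "v1 \<in> G 1" "v = v0 + v1"
  have "(br b v0 - l *s v0) + (br b v1 - l *s v1) \<in> J"
    using v unfolding eigenspace_mod_def by (simp add: bracket_add_right algebra_simps)
  moreover have "br b v0 - l *s v0 \<in> G a \<and> br b v1 - l *s v1 \<in> G ((a + 1) mod 2)"
  proof -
    have "br b v0 \<in> G a" "br b v1 \<in> G ((a + 1) mod 2)"
      using bracket_grading[OF assms(3) _ assms(4) v(2)] bracket_grading[OF assms(3) _ assms(4) v(3)]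
        assms(3) by simp_all
    then show ?thesis
      using assms(5) v(2,3) subspace_even subspace_odd by (auto simp: subspace_diff subspace_scale)
  qed
  ultimately have "br b v0 - l *s v0 \<in> J \<and> br b v1 - l *s v1 \<in> J"
    using graded_split gr_ideal_graded[OF assms(1)] assms(3) by blast
  moreover have "v0 \<in> S" "v1 \<in> S"
    using assms(2) v unfolding graded_def eigenspace_mod_def by blast+
  ultimately show "v0 \<in> eigenspace_mod J S b l \<and> v1 \<in> eigenspace_mod J S b l"
    unfolding eigenspace_mod_def by blast
qed

lemma eigenspace_mod_bracket:
  assumes "gr_ideal J" "S \<subseteq> derived_kernel J K" "\<forall>x v. homogeneous x \<longrightarrow> v \<in> S \<longrightarrow> br x v \<in> S"
    and "a < 2" "b \<in> G a" "a = 0 \<or> l = 0"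
    and "homogeneous x" "v \<in> eigenspace_mod J S b l"
  shows "br x v \<in> eigenspace_mod J S b l"
proof -
  obtain c where c: "c < 2" "x \<in> G c" using assms(7) homogeneous_def by blast
  have v: "v \<in> S" "br b v - l *s v \<in> J" using assms(8) unfolding eigenspace_mod_def by blast+
  have "br b (br x v) - l *s br x v = br (br b x) v + (-1) ^ (a * c) *s br x (br b v - l *s v)"
    using assms(6) super_derivation[OF assms(4) c(1) assms(5) c(2)]
    by (auto simp: bracket_diff_right bracket_scale_right)
  moreover have "br (br b x) v \<in> J"
    using v(1) assms(2,4,5,7) bracket_mem_derived homogeneous_bracket homogeneous_def
    unfolding derived_kernel_def by blast
  moreover have "br x (br b v - l *s v) \<in> J"
    using v(2) gr_ideal_bracket_left[OF assms(1)] by blast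
  ultimately have "br b (br x v) - l *s br x v \<in> J"
    using gr_ideal_subspace[OF assms(1)] by (simp add: subspace_add subspace_scale)
  then show ?thesis using assms(3,7) v(1) unfolding eigenspace_mod_def by blast
qed

lemma admissible_eigenspace_mod:
  assumes "gr_ideal J" "admissible J K S" "a < 2" "b \<in> G a" "a = 0 \<or> l = 0"
    and "\<not> eigenspace_mod J S b l \<subseteq> J"
  shows "admissible J K (eigenspace_mod J S b l)"
proof -
  have S: "subspace S" "J \<subseteq> S" "S \<subseteq> derived_kernel J K" "graded S"
    "\<forall>x v. homogeneous x \<longrightarrow> v \<in> S \<longrightarrow> br x v \<in> S"
    using assms(2) unfolding admissible_def by blast+
  have "J \<subseteq> eigenspace_mod J S b l"
    using S(2) gr_ideal_bracket_left[OF assms(1)] gr_ideal_subspace[OF assms(1)]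
    unfolding eigenspace_mod_def by (auto simp: subspace_diff subspace_scale)
  moreover have "eigenspace_mod J S b l \<subseteq> S" unfolding eigenspace_mod_def by blast
  ultimately show ?thesis
    unfolding admissible_def
    using assms(6) S(3) subspace_eigenspace_mod[OF gr_ideal_subspace[OF assms(1)] S(1)]
      graded_eigenspace_mod[OF assms(1) S(4) assms(3-5)]
      eigenspace_mod_bracket[OF assms(1) S(3,5) assms(3-5)]
    by blast
qed

lemma graded_span_insert:
  assumes "gr_ideal J" "e < 2" "w \<in> G e"
  shows "graded (span (insert w J))"
  unfolding graded_def
proof (intro ballI impI)
  fix y y0 y1
  assume y: "y \<in> span (insert w J)" "y0 \<in> G 0" "y1 \<in> G 1" "y = y0 + y1"
  obtain k j where kj: "j \<in> J" "y = k *s w + j"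
    using y(1) span_insert_subspace_iff[OF gr_ideal_subspace[OF assms(1)]] by blast
  obtain j0 j1 where j: "j0 \<in> G 0" "j1 \<in> G 1" "j = j0 + j1"
    using even_odd_decomposition by blast
  then have "j0 \<in> J" "j1 \<in> J" using gr_ideal_graded[OF assms(1)] kj(1) unfolding graded_def by blast+
  then have in_span: "k *s w + j0 \<in> span (insert w J)" "k *s w + j1 \<in> span (insert w J)"
    "j0 \<in> span (insert w J)" "j1 \<in> span (insert w J)"
    using span_insert_subspace_iff[OF gr_ideal_subspace[OF assms(1)]] by (auto intro: exI[of _ 0])
  from assms(2) show "y0 \<in> span (insert w J) \<and> y1 \<in> span (insert w J)"
  proof (elim parity_cases)
    assume "e = 0"
    then have "(k *s w + j0) + j1 = y0 + y1" "k *s w + j0 \<in> G 0"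
      using kj(2) y(4) j assms(3) subspace_even by (auto simp: add.assoc subspace_add subspace_scale)
    then show ?thesis using even_odd_unique y(2,3) j(2) in_span by metis
  next
    assume "e = 1"
    then have "j0 + (k *s w + j1) = y0 + y1" "k *s w + j1 \<in> G 1"
      using kj(2) y(4) j assms(3) subspace_odd by (auto simp: ac_simps subspace_add subspace_scale)
    then show ?thesis using even_odd_unique y(2,3) j(1) in_span by metis
  qed
qed

lemma exists_homogeneous_spanning_set:
  "\<exists>H. finite H \<and> (\<forall>h\<in>H. homogeneous h) \<and> span H = UNIV"
proof -
  obtain f0 f1 where f: "\<And>v. f0 v \<in> G 0" "\<And>v. f1 v \<in> G 1" "\<And>v. v = f0 v + f1 v"
    using even_odd_decomposition by metis
  define H where "H = f0 ` Basis \<union> f1 ` Basis"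
  have "Basis \<subseteq> span H"
    using f(3) unfolding H_def by (metis UnCI image_eqI span_add span_base subsetI)
  then have "span H = UNIV" using span_Basis span_minimal by blast
  moreover have "finite H" "\<forall>h\<in>H. homogeneous h"
    unfolding H_def using f(1,2) finite_Basis homogeneous_even homogeneous_odd by auto
  ultimately show ?thesis by blast
qed

text \<open>Super antisymmetry turns the left stability of \<open>span (insert w J)\<close> into
  right stability, so adjoining an eigenvector modulo \<open>J\<close> yields an ideal.\<close>
lemma gr_ideal_span_insert:
  assumes "gr_ideal J" "e < 2" "w \<in> G e" "\<And>x. br x w \<in> span (insert w J)"
  shows "gr_ideal (span (insert w J))"
proof -
  let ?L = "span (insert w J)"
  have w_bracket: "br w x \<in> ?L" for x
  proof -
    obtain x0 x1 where x: "x0 \<in> G 0" "x1 \<in> G 1" "x = x0 + x1"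
      using even_odd_decomposition by blast
    have "br w x0 = - br x0 w" "br w x1 = - ((-1) ^ e *s br x1 w)"
      using bracket_super_antisym[of e 0 w x0] bracket_super_antisym[of e 1 w x1] assms(2,3) x(1,2)
      by simp_all
    then have "br w x0 \<in> ?L" "br w x1 \<in> ?L"
      using assms(4) by (simp_all add: span_neg span_scale)
    then show ?thesis using x(3) by (simp add: bracket_add_right span_add)
  qed
  have "br x y \<in> ?L \<and> br y x \<in> ?L" if y: "y \<in> ?L" for x y
  proof -
    obtain k j where "j \<in> J" "y = k *s w + j"
      using y span_insert_subspace_iff[OF gr_ideal_subspace[OF assms(1)]] by blast
    moreover have "J \<subseteq> ?L" using span_superset[of "insert w J"] by blast
    ultimately show ?thesis
      using assms(4) w_bracket gr_ideal_bracket_left[OF assms(1)] gr_ideal_bracket_right[OF assms(1)]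
      by (simp add: bracket_add_left bracket_add_right bracket_scale_left bracket_scale_right
          span_add span_scale subset_iff)
  qed
  then show ?thesis
    unfolding gr_ideal_iff using graded_span_insert[OF assms(1-3)] by simp
qed

end

locale completely_solvable_lie_superalgebra = fd_lie_superalgebra scale Basis G br
  for scale :: "'k::field \<Rightarrow> 'v::ab_group_add \<Rightarrow> 'v" (infixr \<open>*s\<close> 75) and Basis G br +
  assumes char_ne_2: "(2::'k) \<noteq> 0"
    and alg_closed: "alg_closed_field TYPE('k)"
    and completely_solvable: "completely_solvable (*s) br"
begin

text \<open>The square of \<open>br b\<close> is half the action of the derived element \<open>br b b\<close>,
  which vanishes modulo \<open>J\<close> on \<open>S\<close>.\<close>
lemma odd_eigenspace_mod_not_subset:
  assumes "gr_ideal J" "admissible J K S" "b \<in> G 1"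
  shows "\<not> eigenspace_mod J S b 0 \<subseteq> J"
proof (cases "\<forall>v\<in>S. br b v \<in> J")
  case True
  then have "eigenspace_mod J S b 0 = S" unfolding eigenspace_mod_def by auto
  then show ?thesis using assms(2) unfolding admissible_def by auto
next
  case False
  then obtain v where v: "v \<in> S" "br b v \<notin> J" by blast
  have "homogeneous b" using assms(3) by (rule homogeneous_odd)
  have "v \<in> derived_kernel J K" using assms(2) v(1) unfolding admissible_def by blast
  then have "br (br b b) v \<in> J"
    using bracket_mem_derived homogeneous_bracket[OF \<open>homogeneous b\<close> \<open>homogeneous b\<close>]
    unfolding derived_kernel_def by blast
  then have "(1/2) *s (2 *s br b (br b v)) \<in> J"
    unfolding odd_bracket_square[OF assms(3)]
    using gr_ideal_subspace[OF assms(1)] subspace_scale by blast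
  moreover have "br b v \<in> S"
    using assms(2) \<open>homogeneous b\<close> v(1) unfolding admissible_def by blast
  ultimately have "br b v \<in> eigenspace_mod J S b 0"
    using char_ne_2 unfolding eigenspace_mod_def by simp
  then show ?thesis using v(2) by blast
qed

lemma exists_admissible_eigenspace_mod:
  assumes "gr_ideal J" "admissible J K S" "homogeneous b"
  shows "\<exists>l. admissible J K (eigenspace_mod J S b l)"
proof -
  obtain a where a: "a < 2" "b \<in> G a" using assms(3) homogeneous_def by blast
  have "\<exists>l. (a = 0 \<or> l = 0) \<and> \<not> eigenspace_mod J S b l \<subseteq> J"
    using a(1)
  proof (elim parity_cases)
    assume "a = 0"
    moreover have "subspace S" "\<not> S \<subseteq> J" "\<And>v. v \<in> S \<Longrightarrow> br b v \<in> S"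
      using assms(2,3) unfolding admissible_def by blast+
    ultimately show ?thesis
      using eigenvector_mod_subspace[OF alg_closed linear_bracket_right _ gr_ideal_subspace[OF assms(1)]]
      unfolding eigenspace_mod_def by blast
  next
    assume "a = 1"
    then show ?thesis using odd_eigenspace_mod_not_subset[OF assms(1,2)] a(2) by auto
  qed
  then show ?thesis using admissible_eigenspace_mod[OF assms(1,2) a] by blast
qed

lemma exists_simultaneous_eigenspace_mod:
  assumes "finite H" "\<forall>h\<in>H. homogeneous h" "gr_ideal J" "gr_ideal K" "J \<subset> K"
  shows "\<exists>S. admissible J K S \<and> (\<forall>b\<in>H. \<exists>l. \<forall>v\<in>S. br b v - l *s v \<in> J)"
  using assms(1,2)
proof (induction H)
  case empty
  show ?case
    using admissible_derived_kernel[OF _ assms(3-5)] completely_solvable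
    unfolding completely_solvable_def by blast
next
  case (insert b H)
  then obtain S where S: "admissible J K S" "\<forall>b\<in>H. \<exists>l. \<forall>v\<in>S. br b v - l *s v \<in> J"
    by auto
  obtain l where "admissible J K (eigenspace_mod J S b l)"
    using exists_admissible_eigenspace_mod[OF assms(3) S(1)] insert.prems by blast
  moreover have "eigenspace_mod J S b l \<subseteq> S" unfolding eigenspace_mod_def by blast
  ultimately show ?case
    using S(2) unfolding eigenspace_mod_def by blast
qed

lemma exists_weight_vector:
  assumes "gr_ideal J" "gr_ideal K" "J \<subset> K"
  shows "\<exists>w e. e < 2 \<and> w \<in> G e \<and> w \<in> K \<and> w \<notin> J \<and> (\<forall>x. br x w \<in> span (insert w J))"
proof -
  obtain H where H: "finite H" "\<forall>h\<in>H. homogeneous h" "span H = UNIV"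
    using exists_homogeneous_spanning_set by blast
  then obtain S where S: "admissible J K S" "\<forall>b\<in>H. \<exists>l. \<forall>v\<in>S. br b v - l *s v \<in> J"
    using exists_simultaneous_eigenspace_mod[OF _ _ assms] by blast
  then obtain v where "v \<in> S" "v \<notin> J" unfolding admissible_def by blast
  obtain v0 v1 where v: "v0 \<in> G 0" "v1 \<in> G 1" "v = v0 + v1"
    using even_odd_decomposition by blast
  have "v0 \<in> S" "v1 \<in> S" "v0 \<notin> J \<or> v1 \<notin> J"
    using \<open>v \<in> S\<close> \<open>v \<notin> J\<close> v S(1) gr_ideal_subspace[OF assms(1)] subspace_add
    unfolding admissible_def graded_def by metis+
  moreover have "0 < (2::nat)" "1 < (2::nat)" by simp_all
  ultimately obtain w e where w: "e < 2" "w \<in> G e" "w \<in> S" "w \<notin> J"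
    using v(1,2) by blast
  have "H \<subseteq> (\<lambda>x. br x w) -` span (insert w J)"
  proof
    fix h assume "h \<in> H"
    then obtain l where "br h w - l *s w \<in> J" using S(2) w(3) by blast
    then show "h \<in> (\<lambda>x. br x w) -` span (insert w J)"
      using span_insert_subspace_iff[OF gr_ideal_subspace[OF assms(1)]]
      by (metis add.commute diff_add_cancel vimageI2)
  qed
  moreover have "subspace ((\<lambda>x. br x w) -` span (insert w J))"
  proof -
    interpret ad: Vector_Spaces.linear "(*s)" "(*s)" "\<lambda>x. br x w"
      by (rule linear_bracket_left)
    show ?thesis by (rule ad.subspace_vimage) simp
  qed
  ultimately have "br x w \<in> span (insert w J)" for x
    using span_minimal[of H] H(3) by blast
  moreover have "w \<in> K"
    using w(3) S(1) unfolding admissible_def derived_kernel_def by blast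
  ultimately show ?thesis using w by blast
qed

lemma graded_ideal_step:
  assumes "gr_ideal J" "gr_ideal K" "J \<subset> K"
  shows "\<exists>L. gr_ideal L \<and> J \<subset> L \<and> L \<subseteq> K \<and> dim L = dim J + 1"
proof -
  obtain w e where w: "e < 2" "w \<in> G e" "w \<in> K" "w \<notin> J" "\<And>x. br x w \<in> span (insert w J)"
    using exists_weight_vector[OF assms] by blast
  have "w \<notin> span J"
    using w(4) span_eq_iff[THEN iffD2, OF gr_ideal_subspace[OF assms(1)]] by (simp del: span_eq_iff)
  then have "dim (span (insert w J)) = dim J + 1" by (simp add: dim_insert)
  moreover have "J \<subset> span (insert w J)" using w(4) span_superset[of "insert w J"] by auto
  moreover have "span (insert w J) \<subseteq> K"
    using span_minimal[of "insert w J" K] assms(3) w(3) gr_ideal_subspace[OF assms(2)] by blast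
  ultimately show ?thesis using gr_ideal_span_insert[OF assms(1) w(1,2,5)] by blast
qed

lemma dim_minimal_graded_ideal:
  assumes "minimal_graded_ideal (*s) G br I"
  shows "dim I = 1"
proof -
  have I: "gr_ideal I" "I \<noteq> {0}" "\<And>J. gr_ideal J \<Longrightarrow> J \<subseteq> I \<Longrightarrow> J = {0} \<or> J = I"
    using assms unfolding minimal_graded_ideal_def by blast+
  then have "{0} \<subset> I" using subspace_0[OF gr_ideal_subspace[OF I(1)]] by blast
  then obtain L where "gr_ideal L" "{0} \<subset> L" "L \<subseteq> I" "dim L = 1"
    using graded_ideal_step[OF gr_ideal_zero I(1)] by auto
  then show ?thesis using I(3) by force
qed

lemma exists_graded_ideal_flag:
  assumes "k \<le> dim (UNIV :: 'v set)"
  shows "\<exists>C. C 0 = {0} \<and> (\<forall>i\<le>k. gr_ideal (C i) \<and> dim (C i) = i) \<and> (\<forall>i<k. C i \<subseteq> C (Suc i))"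
  using assms
proof (induction k)
  case 0
  show ?case using gr_ideal_zero by (intro exI[of _ "\<lambda>_. {0}"]) simp
next
  case (Suc k)
  then obtain C where C: "C 0 = {0}" "\<forall>i\<le>k. gr_ideal (C i) \<and> dim (C i) = i"
    "\<forall>i<k. C i \<subseteq> C (Suc i)"
    by auto
  have "C k \<noteq> UNIV" using C(2) Suc.prems by auto
  then obtain L where L: "gr_ideal L" "C k \<subset> L" "dim L = Suc k"
    using graded_ideal_step[of "C k" UNIV] C(2) gr_ideal_UNIV by auto
  define C' where "C' = C(Suc k := L)"
  have "C' 0 = {0}" using C(1) by (simp add: C'_def)
  moreover have "gr_ideal (C' i) \<and> dim (C' i) = i" if "i \<le> Suc k" for i
    using that C(2) L(1,3) by (cases "i = Suc k") (auto simp: C'_def)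
  moreover have "C' i \<subseteq> C' (Suc i)" if "i < Suc k" for i
    using that C(3) L(2) by (cases "i = k") (auto simp: C'_def)
  ultimately show ?case by blast
qed

lemma graded_ideal_chain:
  defines "N \<equiv> dim (UNIV :: 'v set)"
  shows "\<exists>C. C 0 = UNIV \<and> C N = {0} \<and> (\<forall>i<N. C (Suc i) \<subseteq> C i) \<and>
    (\<forall>i\<le>N. gr_ideal (C i) \<and> dim (C i) = N - i)"
proof -
  have "N \<le> dim (UNIV :: 'v set)" by (simp add: N_def)
  from exists_graded_ideal_flag[OF this] obtain C where C: "C 0 = {0}"
    "\<forall>i\<le>N. gr_ideal (C i) \<and> dim (C i) = i" "\<forall>i<N. C i \<subseteq> C (Suc i)"
    by blast
  have "dim (C N) = dimension" "subspace (C N)"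
    using C(2) gr_ideal_subspace by (auto simp: N_def dimension_def)
  then have top: "C N = UNIV" using dim_eq_full span_eq_iff by metis
  have descending: "C (N - Suc i) \<subseteq> C (N - i)" if "i < N" for i
  proof -
    have "N - Suc i < N" "Suc (N - Suc i) = N - i" using that by simp_all
    then show ?thesis using C(3) by metis
  qed
  show ?thesis
  proof (intro exI[of _ "\<lambda>i. C (N - i)"] conjI allI impI)
    show "C (N - 0) = UNIV" using top by simp
    show "C (N - N) = {0}" using C(1) by simp
    fix i
    show "i < N \<Longrightarrow> C (N - Suc i) \<subseteq> C (N - i)" by (rule descending)
    show "i \<le> N \<Longrightarrow> gr_ideal (C (N - i))" using C(2) by simp
    show "i \<le> N \<Longrightarrow> dim (C (N - i)) = N - i" using C(2) by simp
  qed
qed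

end

theorem lemma5p1:
  fixes scale :: "'k::field \<Rightarrow> 'v::ab_group_add \<Rightarrow> 'v"
    and G :: "nat \<Rightarrow> 'v set"
    and br :: "'v \<Rightarrow> 'v \<Rightarrow> 'v"
    and N :: nat
  assumes "alg_closed_field TYPE('k)"
    and "prime CHAR('k)" and "CHAR('k) > 2"
    and "lie_superalgebra scale G br"
    and "fin_dim scale"
    and "completely_solvable scale br"
    and "N = vector_space.dim scale (UNIV :: 'v set)"
  shows "(\<forall>I. minimal_graded_ideal scale G br I \<longrightarrow> vector_space.dim scale I = 1) \<and>
         (\<exists>C :: nat \<Rightarrow> 'v set. C 0 = UNIV \<and> C N = {0} \<and>
            (\<forall>i<N. C (Suc i) \<subseteq> C i) \<and>
            (\<forall>i\<le>N. graded_ideal scale G br (C i) \<and> vector_space.dim scale (C i) = N - i))"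
proof -
  have "vector_space scale" using assms(4) unfolding lie_superalgebra_def by blast
  then obtain B where "finite_dimensional_vector_space scale B"
    using finite_dimensional_vector_spaceI assms(5) by blast
  then interpret completely_solvable_lie_superalgebra scale B G br
    using assms(1,3,4,6) two_ne_zero_if_CHAR_gt_2
    by (simp add: completely_solvable_lie_superalgebra_def fd_lie_superalgebra_def
        completely_solvable_lie_superalgebra_axioms_def fd_lie_superalgebra_axioms_def)
  show ?thesis
    using dim_minimal_graded_ideal graded_ideal_chain unfolding assms(7) by blast
qed

end
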